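(* Let $a,b$ be real constants with $b\neq 0$. Let $\Gamma$ be an open arc of the unit circle $\{|z|=1\}$ centered at the origin, let $\Omega\subset\mathbb{C}\setminus\{0\}$ be a simply connected domain containing $\Gamma$, and let $\varphi_w$ be a function on $\Gamma$ that continues holomorphically into $\mathbb{C}^2$ near $\Gamma$. Let $w$ be a harmonic function in $\Omega$ satisfying the Robin condition $a\,w+b\,\frac{\partial w}{\partial n}=\varphi_w$ on $\Gamma$, and write its complexification as $w(z,\zeta)=w_1(z)+w_2(\zeta)$, with $w_1$ holomorphic in $\Omega$ and $w_2$ holomorphic in $\Omega^*=\{\bar z:z\in\Omega\}$. Fix $z_0\in\Gamma$, $\zeta_0=\bar z_0$, and an arbitrary constant $v(z_0,\zeta_0)$. Then the function $$v(z,\zeta)=v(z_0,\zeta_0)+\frac{b}{2}\bigl[w(z,\zeta)-w(z_0,\zeta_0)\bigr]-\frac{a}{2}\int_z^{z_0}\frac{w_1(\tau)}{\tau}\,d\tau-\frac{a}{2}\int_\zeta^{\zeta_0}\frac{w_2(\xi)}{\xi}\,d\xi ,$$ where the integrals are taken along paths in $\Omega$ and $\Omega^*$ respectively, is harmonic in $\Omega$ (that is, $z\mapsto v(z,\bar z)$ is harmonic in $\Omega$) and satisfies the Neumann condition $\frac{\partial v}{\partial n}=\frac12\varphi_w$ on $\Gamma$.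
   Context: Points of $\mathbb{R}^2$ are identified with $z=x+iy\in\mathbb{C}$. A harmonic function $w(x,y)$ is complexified via $z=x+iy$, $\zeta=x-iy$, regarded as independent complex variables; the complexified function is written $w(z,\zeta)$, and the real plane corresponds to $\zeta=\bar z$. On a simply connected domain $\Omega$ every harmonic function has the form $w(z,\zeta)=w_1(z)+w_2(\zeta)$ as in the claim. Here $n$ is the outward unit normal to the unit circle, so $\frac{\partial}{\partial n}$ on $\Gamma$ is the radial derivative at $r=|z|=1$. *)

theory Defs
  imports "HOL-Complex_Analysis.Complex_Analysis"
begin

definition deriv_along :: "complex \<Rightarrow> (complex \<Rightarrow> complex) \<Rightarrow> complex \<Rightarrow> complex" where
  "deriv_along d f z = frechet_derivative f (at z) d"

text \<open>With \<open>z = x + iy\<close>, the directions \<open>1\<close> and \<open>\<i>\<close> give the partial derivatives in \<open>x\<close> and \<open>y\<close>.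
  Harmonic functions are allowed to be complex-valued.\<close>

definition C2_on :: "(complex \<Rightarrow> complex) \<Rightarrow> complex set \<Rightarrow> bool" where
  "C2_on f S \<longleftrightarrow>
     (\<forall>z\<in>S. f differentiable (at z)) \<and>
     (\<forall>d\<in>{1, \<i>}. \<forall>z\<in>S. deriv_along d f differentiable (at z)) \<and>
     (\<forall>d\<in>{1, \<i>}. \<forall>e\<in>{1, \<i>}. continuous_on S (deriv_along e (deriv_along d f)))"

definition laplacian :: "(complex \<Rightarrow> complex) \<Rightarrow> complex \<Rightarrow> complex" where
  "laplacian f z = deriv_along 1 (deriv_along 1 f) z + deriv_along \<i> (deriv_along \<i> f) z"

definition harmonic_on :: "(complex \<Rightarrow> complex) \<Rightarrow> complex set \<Rightarrow> bool" where
  "harmonic_on f S \<longleftrightarrow> C2_on f S \<and> (\<forall>z\<in>S. laplacian f z = 0)"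

text \<open>The outward unit normal to the unit circle at a point \<open>z\<close> of the circle is \<open>z\<close> itself.\<close>

definition circle_normal_deriv :: "(complex \<Rightarrow> complex) \<Rightarrow> complex \<Rightarrow> complex" where
  "circle_normal_deriv f z = deriv_along z f z"

text \<open>The bound \<open>\<beta> \<le> \<alpha> + 2 * pi\<close> rules out the full circle.\<close>

definition open_circle_arc :: "complex set \<Rightarrow> bool" where
  "open_circle_arc \<Gamma> \<longleftrightarrow> (\<exists>\<alpha> \<beta>. \<alpha> < \<beta> \<and> \<beta> \<le> \<alpha> + 2 * pi \<and> \<Gamma> = cis ` {\<alpha><..<\<beta>})"

text \<open>Holomorphy in two complex variables: the real derivative exists and is complex-linear.\<close>

definition holomorphic2_on :: "(complex \<times> complex \<Rightarrow> complex) \<Rightarrow> (complex \<times> complex) set \<Rightarrow> bool" where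
  "holomorphic2_on F U \<longleftrightarrow>
     (\<forall>p\<in>U. \<exists>D. (F has_derivative D) (at p) \<and> (\<forall>c h k. D (c * h, c * k) = c * D (h, k)))"

text \<open>The real plane sits in \<open>\<complex>\<^sup>2\<close> as the set of points \<open>(z, cnj z)\<close>.\<close>

definition continues_holomorphically :: "(complex \<Rightarrow> complex) \<Rightarrow> complex set \<Rightarrow> bool" where
  "continues_holomorphically \<phi> \<Gamma> \<longleftrightarrow>
     (\<exists>U F. open U \<and> (\<lambda>z. (z, cnj z)) ` \<Gamma> \<subseteq> U \<and> holomorphic2_on F U \<and>
            (\<forall>z\<in>\<Gamma>. F (z, cnj z) = \<phi> z))"

definition path_between :: "complex set \<Rightarrow> complex \<Rightarrow> complex \<Rightarrow> (real \<Rightarrow> complex) \<Rightarrow> bool" where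
  "path_between S p q g \<longleftrightarrow>
     valid_path g \<and> path_image g \<subseteq> S \<and> pathstart g = p \<and> pathfinish g = q"

end

theory Submission
  imports Defs
begin

text \<open>
  With primitives \<open>W1\<close> of \<open>w1 \<tau> / \<tau>\<close> on \<open>\<Omega>\<close> and \<open>W2\<close> of \<open>w2 \<xi> / \<xi>\<close> on the conjugate domain, the
  function \<open>v\<close> splits as \<open>f z + g (cnj z)\<close> with \<open>f\<close>, \<open>g\<close> holomorphic, and every such sum is harmonic.
  The derivative in the radial direction is \<open>z \<partial>/\<partial>z + \<zeta> \<partial>/\<partial>\<zeta>\<close>; it cancels the
  denominators \<open>\<tau>\<close> and \<open>\<xi>\<close>, so the integral terms contribute \<open>(a / 2) (w1 + w2)\<close> and the normal
  derivative of \<open>v\<close> is half of the left-hand side of the Robin condition.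
\<close>

lemma open_cnj_image:
  assumes "open S"
  shows "open (cnj ` S)"
proof -
  have "cnj ` S = cnj -` S"
    by (auto simp: image_iff) (metis complex_cnj_cnj)
  then show ?thesis
    using assms by (simp add: continuous_open_vimage)
qed

lemma simply_connected_cnj_image:
  assumes "simply_connected S"
  shows "simply_connected (cnj ` S)"
proof -
  have "homeomorphism S (cnj ` S) cnj cnj"
    by (auto simp: homeomorphism_def image_image intro!: continuous_intros)
  then have "S homeomorphic cnj ` S"
    by (auto simp: homeomorphic_def)
  then show ?thesis
    using assms homeomorphic_simply_connected by blast
qed

text \<open>Simple connectedness gives \<open>h\<close> a global primitive, so an integral depends
  only on the endpoints of its path. This is what makes the arbitrary choice of a path for each
  point harmless: no regularity in the endpoint is asked of that choice.\<close>

lemma contour_integral_primitive_difference: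
  assumes "open S" "simply_connected S" "h holomorphic_on S"
  obtains H where "\<And>z. z \<in> S \<Longrightarrow> (H has_field_derivative h z) (at z)"
    and "\<And>p q g. path_between S p q g \<Longrightarrow> contour_integral g h = H q - H p"
proof -
  obtain H where H: "\<And>z. z \<in> S \<Longrightarrow> (H has_field_derivative h z) (at z)"
    using assms simply_connected_eq_global_primitive by blast
  moreover have "contour_integral g h = H q - H p" if "path_between S p q g" for p q g
  proof -
    have "(h has_contour_integral (H (pathfinish g) - H (pathstart g))) g"
      using that H by (intro contour_integral_primitive[of S])
        (auto simp: path_between_def intro: has_field_derivative_at_within)
    then show ?thesis
      using that by (simp add: path_between_def contour_integral_unique)
  qed
  ultimately show ?thesis
    using that by blast
qed

text \<open>Conjugation is real-linear, hence its own derivative, and the chain rule does the rest;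
  \<open>f'\<close> and \<open>g'\<close> are the two Wirtinger derivatives of \<open>F\<close>. The
  splitting is only known on \<open>S\<close>, and openness of \<open>S\<close> makes this enough
  for the derivative at \<open>z\<close>.\<close>

lemma has_derivative_holomorphic_plus_antiholomorphic:
  assumes "open S" "z \<in> S" "\<And>x. x \<in> S \<Longrightarrow> F x = f x + g (cnj x)"
    and "(f has_field_derivative f') (at z)" "(g has_field_derivative g') (at (cnj z))"
  shows "(F has_derivative (\<lambda>d. d * f' + cnj d * g')) (at z)"
proof -
  have "(f has_derivative (\<lambda>d. f' * d)) (at z)"
    using assms(4) by (simp add: has_field_derivative_def)
  moreover have "((\<lambda>x. g (cnj x)) has_derivative (\<lambda>d. g' * cnj d)) (at z)"
    using assms(5)
    by (intro has_derivative_compose[of cnj cnj z UNIV g "\<lambda>d. g' * d"] bounded_linear_imp_has_derivative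
        bounded_linear_cnj) (simp_all add: has_field_derivative_def)
  ultimately have "((\<lambda>x. f x + g (cnj x)) has_derivative (\<lambda>d. f' * d + g' * cnj d)) (at z)"
    by (rule has_derivative_add)
  then have "(F has_derivative (\<lambda>d. f' * d + g' * cnj d)) (at z)"
    by (rule has_derivative_transform_within_open[OF _ assms(1,2)]) (simp add: assms(3))
  then show ?thesis
    by (simp add: mult.commute)
qed

lemma deriv_along_holomorphic_plus_antiholomorphic:
  assumes "open S" "z \<in> S" "\<And>x. x \<in> S \<Longrightarrow> F x = f x + g (cnj x)"
    and "(f has_field_derivative f') (at z)" "(g has_field_derivative g') (at (cnj z))"
  shows "deriv_along d F z = d * f' + cnj d * g'"
  using frechet_derivative_at[OF has_derivative_holomorphic_plus_antiholomorphic[OF assms]]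
  unfolding deriv_along_def by metis

text \<open>Differentiation along \<open>d\<close> turns the pair (\<open>f\<close>,
  \<open>g\<close>) into (\<open>d * f'\<close>, \<open>cnj d * g'\<close>), which is again a
  holomorphic pair. The class of such sums is thus closed under directional derivatives, and all
  orders are handled by iterating one rule.\<close>

lemma harmonic_on_holomorphic_plus_antiholomorphic:
  assumes S: "open S" and F: "\<And>x. x \<in> S \<Longrightarrow> F x = f x + g (cnj x)"
    and f: "f holomorphic_on S" and g: "g holomorphic_on cnj ` S"
  shows "harmonic_on F S"
proof -
  have S': "open (cnj ` S)"
    using S by (rule open_cnj_image)
  \<comment> \<open>Both facts are stated for arbitrary \<open>G\<close>, \<open>p\<close>,
    \<open>q\<close>, so that they apply again to the directional derivatives of
    \<open>F\<close>.\<close>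
  have diff: "G differentiable (at z)"
    and along: "deriv_along d G z = d * deriv p z + cnj d * deriv q (cnj z)"
    if "\<And>x. x \<in> S \<Longrightarrow> G x = p x + q (cnj x)" "p holomorphic_on S" "q holomorphic_on cnj ` S" "z \<in> S"
    for G p q z d
  proof -
    have p: "(p has_field_derivative deriv p z) (at z)"
      using that S by (intro holomorphic_derivI)
    have q: "(q has_field_derivative deriv q (cnj z)) (at (cnj z))"
      using that S' by (intro holomorphic_derivI) auto
    show "G differentiable (at z)"
      using has_derivative_holomorphic_plus_antiholomorphic[OF S that(4,1) p q]
      by (auto simp: differentiable_def)
    show "deriv_along d G z = d * deriv p z + cnj d * deriv q (cnj z)"
      using S that(4,1) p q by (rule deriv_along_holomorphic_plus_antiholomorphic)
  qed
  have holo: "(\<lambda>z. d * deriv p z) holomorphic_on T" if "p holomorphic_on T" "open T" for d p T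
    using that by (intro holomorphic_intros holomorphic_deriv)
  have first: "deriv_along d F z = d * deriv f z + cnj d * deriv g (cnj z)" if "z \<in> S" for d z
    using along[OF F f g that] .
  have diff1: "deriv_along d F differentiable (at z)" if "z \<in> S" for d z
    using diff[OF first holo[OF f S] holo[OF g S'] that] .
  have second: "deriv_along e (deriv_along d F) z
      = e * deriv (\<lambda>z. d * deriv f z) z + cnj e * deriv (\<lambda>z. cnj d * deriv g z) (cnj z)"
    if "z \<in> S" for d e z
    using along[OF first holo[OF f S] holo[OF g S'] that] .
  \<comment> \<open>A third application of the rule: differentiability of the second derivatives
    yields the continuity that \<open>C2_on\<close> demands.\<close>
  have "deriv_along e (deriv_along d F) differentiable (at z)" if "z \<in> S" for d e z
    using diff[OF second holo[OF holo[OF f S] S] holo[OF holo[OF g S'] S'] that] .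
  then have "continuous_on S (deriv_along e (deriv_along d F))" for d e
    using differentiable_imp_continuous_within by (blast intro: continuous_at_imp_continuous_on)
  moreover have "laplacian F z = 0" if "z \<in> S" for z
  proof -
    have "deriv (\<lambda>z. d * deriv f z) z = d * deriv (deriv f) z" for d
      using that S f by (intro deriv_cmult holomorphic_on_imp_differentiable_at[of _ S] holomorphic_deriv)
    moreover have "deriv (\<lambda>z. d * deriv g z) (cnj z) = d * deriv (deriv g) (cnj z)" for d
      using that S' g
      by (intro deriv_cmult holomorphic_on_imp_differentiable_at[of _ "cnj ` S"] holomorphic_deriv) auto
    ultimately have "deriv_along d (deriv_along d F) z
        = d\<^sup>2 * deriv (deriv f) z + (cnj d)\<^sup>2 * deriv (deriv g) (cnj z)" for d
      unfolding second[OF that] by (simp add: power2_eq_square mult.assoc)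
    \<comment> \<open>The directions 1 and \<i> have squares 1 and -1, and so do their conjugates;
      both terms cancel in the sum.\<close>
    then show ?thesis
      by (simp add: laplacian_def)
  qed
  ultimately show ?thesis
    using diff[OF F f g] diff1 by (auto simp: harmonic_on_def C2_on_def)
qed

theorem theorem3:
  fixes a b :: real
    and \<Gamma> \<Omega> :: "complex set"
    and \<phi> w1 w2 :: "complex \<Rightarrow> complex"
    and w v :: "complex \<Rightarrow> complex \<Rightarrow> complex"
    and z0 \<zeta>0 v0 :: complex
    and \<gamma> \<delta> :: "complex \<Rightarrow> real \<Rightarrow> complex"
  assumes "b \<noteq> 0"
    and "open_circle_arc \<Gamma>"
    and "open \<Omega>" "connected \<Omega>" "simply_connected \<Omega>" "0 \<notin> \<Omega>" "\<Gamma> \<subseteq> \<Omega>"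
    and "continues_holomorphically \<phi> \<Gamma>"
    and "harmonic_on (\<lambda>z. w z (cnj z)) \<Omega>"
    and "\<And>z. z \<in> \<Gamma> \<Longrightarrow>
           of_real a * w z (cnj z) + of_real b * circle_normal_deriv (\<lambda>z. w z (cnj z)) z = \<phi> z"
    and "w1 holomorphic_on \<Omega>" "w2 holomorphic_on (cnj ` \<Omega>)"
    and "\<And>z \<zeta>. z \<in> \<Omega> \<Longrightarrow> \<zeta> \<in> cnj ` \<Omega> \<Longrightarrow> w z \<zeta> = w1 z + w2 \<zeta>"
    and "z0 \<in> \<Gamma>" "\<zeta>0 = cnj z0"
    and "\<And>z. z \<in> \<Omega> \<Longrightarrow> path_between \<Omega> z z0 (\<gamma> z)"
    and "\<And>\<zeta>. \<zeta> \<in> cnj ` \<Omega> \<Longrightarrow> path_between (cnj ` \<Omega>) \<zeta> \<zeta>0 (\<delta> \<zeta>)"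
    and "\<And>z \<zeta>. z \<in> \<Omega> \<Longrightarrow> \<zeta> \<in> cnj ` \<Omega> \<Longrightarrow>
           v z \<zeta> = v0 + of_real b / 2 * (w z \<zeta> - w z0 \<zeta>0)
                   - of_real a / 2 * contour_integral (\<gamma> z) (\<lambda>\<tau>. w1 \<tau> / \<tau>)
                   - of_real a / 2 * contour_integral (\<delta> \<zeta>) (\<lambda>\<xi>. w2 \<xi> / \<xi>)"
  shows "harmonic_on (\<lambda>z. v z (cnj z)) \<Omega> \<and>
         (\<forall>z\<in>\<Gamma>. circle_normal_deriv (\<lambda>z. v z (cnj z)) z = \<phi> z / 2)"
proof -
  have S': "open (cnj ` \<Omega>)" "simply_connected (cnj ` \<Omega>)" "0 \<notin> cnj ` \<Omega>"
    using assms open_cnj_image simply_connected_cnj_image by auto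
  have quot: "(\<lambda>\<tau>. w1 \<tau> / \<tau>) holomorphic_on \<Omega>" "(\<lambda>\<xi>. w2 \<xi> / \<xi>) holomorphic_on cnj ` \<Omega>"
    using assms(6,11,12) S'(3) by (auto intro!: holomorphic_intros)
  obtain W1 where W1: "\<And>z. z \<in> \<Omega> \<Longrightarrow> (W1 has_field_derivative w1 z / z) (at z)"
    and int1: "\<And>p q g. path_between \<Omega> p q g \<Longrightarrow> contour_integral g (\<lambda>\<tau>. w1 \<tau> / \<tau>) = W1 q - W1 p"
    using contour_integral_primitive_difference[OF assms(3,5) quot(1)] by metis
  obtain W2 where W2: "\<And>z. z \<in> cnj ` \<Omega> \<Longrightarrow> (W2 has_field_derivative w2 z / z) (at z)"
    and int2: "\<And>p q g. path_between (cnj ` \<Omega>) p q g \<Longrightarrow>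
                 contour_integral g (\<lambda>\<xi>. w2 \<xi> / \<xi>) = W2 q - W2 p"
    using contour_integral_primitive_difference[OF S'(1,2) quot(2)] by metis
  \<comment> \<open>All constants are put into \<open>f\<close>. The primitives enter with a plus
    sign because the paths run from the variable point to the base point.\<close>
  define f where "f z = v0 - of_real b / 2 * w z0 \<zeta>0 - of_real a / 2 * (W1 z0 + W2 \<zeta>0)
                        + (of_real b / 2 * w1 z + of_real a / 2 * W1 z)" for z
  define g where "g \<xi> = of_real b / 2 * w2 \<xi> + of_real a / 2 * W2 \<xi>" for \<xi>
  have v: "v z (cnj z) = f z + g (cnj z)" if "z \<in> \<Omega>" for z
  proof -
    have z: "cnj z \<in> cnj ` \<Omega>"
      using that by simp
    show ?thesis
      unfolding assms(18)[OF that z] assms(13)[OF that z] int1[OF assms(16)[OF that]]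
        int2[OF assms(17)[OF z]] f_def g_def
      by (simp add: algebra_simps add_divide_distrib diff_divide_distrib)
  qed
  have f': "(f has_field_derivative of_real b / 2 * deriv w1 z + of_real a / 2 * (w1 z / z)) (at z)"
    if "z \<in> \<Omega>" for z
    unfolding f_def using that holomorphic_derivI[OF assms(11,3)] W1
    by (auto intro!: derivative_eq_intros)
  have g': "(g has_field_derivative of_real b / 2 * deriv w2 z + of_real a / 2 * (w2 z / z)) (at z)"
    if "z \<in> cnj ` \<Omega>" for z
    unfolding g_def using that holomorphic_derivI[OF assms(12) S'(1)] W2
    by (auto intro!: derivative_eq_intros)
  have "f holomorphic_on \<Omega>" "g holomorphic_on cnj ` \<Omega>"
    using f' g' holomorphic_on_open assms(3) S'(1) by blast+
  then have "harmonic_on (\<lambda>z. v z (cnj z)) \<Omega>"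
    using assms(3) v by (intro harmonic_on_holomorphic_plus_antiholomorphic[of _ _ f g])
  moreover have "circle_normal_deriv (\<lambda>z. v z (cnj z)) z = \<phi> z / 2" if "z \<in> \<Gamma>" for z
  proof -
    have z: "z \<in> \<Omega>" "cnj z \<in> cnj ` \<Omega>" "z \<noteq> 0"
      using that assms(6,7) by auto
    \<comment> \<open>The same rule with \<open>d = z\<close> rewrites the normal derivative in the
      Robin condition through \<open>w1\<close> and \<open>w2\<close>.\<close>
    have "circle_normal_deriv (\<lambda>z. w z (cnj z)) z = z * deriv w1 z + cnj z * deriv w2 (cnj z)"
      unfolding circle_normal_deriv_def using z assms(13) assms(3)
        holomorphic_derivI[OF assms(11,3)] holomorphic_derivI[OF assms(12) S'(1)]
      by (intro deriv_along_holomorphic_plus_antiholomorphic[of \<Omega>]) auto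
    moreover
    have "circle_normal_deriv (\<lambda>z. v z (cnj z)) z
        = z * (of_real b / 2 * deriv w1 z + of_real a / 2 * (w1 z / z))
          + cnj z * (of_real b / 2 * deriv w2 (cnj z) + of_real a / 2 * (w2 (cnj z) / cnj z))"
      unfolding circle_normal_deriv_def using assms(3) z(1) v f'[OF z(1)] g'[OF z(2)]
      by (rule deriv_along_holomorphic_plus_antiholomorphic)
    \<comment> \<open>Since \<open>z\<close> and \<open>cnj z\<close> are nonzero, the quotients
      cancel, and regrouping by \<open>a\<close> and \<open>b\<close> exhibits half of the Robin
      expression.\<close>
    then have "circle_normal_deriv (\<lambda>z. v z (cnj z)) z
        = (of_real a * (w1 z + w2 (cnj z))
           + of_real b * (z * deriv w1 z + cnj z * deriv w2 (cnj z))) / 2"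
      using z(3) by (simp add: algebra_simps add_divide_distrib)
    ultimately show ?thesis
      using assms(10)[OF that] assms(13)[OF z(1,2)] by simp
  qed
  ultimately show ?thesis
    by blast
qed

end
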